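(* Let $q\in\mathbb{C}$ with $|q|<1$. Then the following four identities hold: $$\sum_{n=0}^\infty \frac{(-1)_n^2\, q^{\binom{n+1}{2}}}{(q)_n(q;q^2)_n}=(-q)_\infty^2(-q;q^2)_\infty^2,$$ $$\sum_{n=0}^\infty \frac{(-1;q^2)_n\, q^{\binom{n+1}{2}}}{(q)_n(q;q^2)_n}=(-q)_\infty^2(-q^2;q^4)_\infty,$$ $$1+3\sum_{n=1}^\infty \frac{(q^3;q^3)_{n-1}\, q^{\binom{n+1}{2}}}{(q)_{n-1}(q)_n(q;q^2)_n}=(-q)_\infty^3(q^3;q^6)_\infty,$$ $$1+\sum_{n=1}^\infty \frac{(-q^3;q^3)_{n-1}\, q^{\binom{n+1}{2}}}{(-q)_{n-1}(q)_n(q;q^2)_n}=\frac{1}{(q;q^2)_\infty(q^2,q^3,q^9,q^{10};q^{12})_\infty}.$$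
   Context: $(a;p)_n=\prod_{j=1}^{n}(1-ap^{j-1})$ for $n\ge0$ (with $(a;p)_0=1$), $(a;p)_\infty=\prod_{j\ge0}(1-ap^j)$, $(a_1,\dots,a_m;p)_\infty=\prod_i(a_i;p)_\infty$; when the base is omitted it is $q$: $(a)_n=(a;q)_n$, $(a)_\infty=(a;q)_\infty$. In particular $(-1)_n=(-1;q)_n$ is a $q$-shifted factorial, and $(-1)_n^2$ is its square. *)

theory Defs
  imports "HOL-Analysis.Analysis"
begin

definition qpoch :: "complex \<Rightarrow> complex \<Rightarrow> nat \<Rightarrow> complex" where
  "qpoch a p n = (\<Prod>j=1..n. 1 - a * p ^ (j - 1))"

definition qpoch_inf :: "complex \<Rightarrow> complex \<Rightarrow> complex" where
  "qpoch_inf a p = (\<Prod>j. 1 - a * p ^ j)"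

definition qpoch_inf_list :: "complex list \<Rightarrow> complex \<Rightarrow> complex" where
  "qpoch_inf_list as p = (\<Prod>a\<leftarrow>as. qpoch_inf a p)"

text \<open>The infinite product above converges for every base in the open unit disc (vanishing
  factors included), so \<open>qpoch_inf\<close> is never evaluated outside its domain of convergence.\<close>

lemma qpoch_inf_has_prod:
  assumes "norm p < 1"
  shows "(\<lambda>j. 1 - a * p ^ j) has_prod qpoch_inf a p"
proof -
  have "summable (\<lambda>j. norm a * norm p ^ j)"
    using assms by (intro summable_mult summable_geometric) simp
  then have "summable (\<lambda>j. norm ((1 - a * p ^ j) - 1))"
    by (simp add: norm_mult norm_power)
  then have "convergent_prod (\<lambda>j. 1 - a * p ^ j)"
    by (intro abs_convergent_prod_imp_convergent_prod summable_imp_abs_convergent_prod)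
  then show ?thesis
    unfolding qpoch_inf_def by (rule convergent_prod_has_prod)
qed

end

(* All four sums are instances, at a = -1, i, w, -w with w a primitive cube root of unity and
   b = 1/a, of Andrews' q-analogue of Gauss's second theorem:
   sum (a)_n (b)_n q^(n+1 choose 2) / ((q)_n (abq;q^2)_n)
     = (-q)_inf (aq;q^2)_inf (bq;q^2)_inf / (abq;q^2)_inf.
   Replacing b by b q^2 multiplies the sum S(a,b) by (1 - abq) / (1 - bq), because the difference
   of the two series telescopes. Iterating gives S(a,b) (abq;q^2)_inf = (bq;q^2)_inf S(a,0); since
   S is symmetric, S(a,0) = (aq;q^2)_inf S(0,0), and S(0,0) is found from the trivial S(0,1) = 1. *)

theory Submission
  imports Defs
begin

section \<open>Finite and infinite q-shifted factorials: nonvanishing, bounds and limits\<close>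

lemma qpoch_lessThan: "qpoch a p n = (\<Prod>j<n. 1 - a * p ^ j)"
  unfolding qpoch_def
  by (rule prod.reindex_bij_witness[of _ Suc "\<lambda>j. j - 1"]) auto

lemma qpoch_0 [simp]: "qpoch a p 0 = 1"
  by (simp add: qpoch_lessThan)

lemma qpoch_Suc: "qpoch a p (Suc n) = qpoch a p n * (1 - a * p ^ n)"
  by (simp add: qpoch_lessThan)

lemma qpoch_Suc_left: "qpoch a p (Suc n) = (1 - a) * qpoch (a * p) p n"
  by (simp add: qpoch_lessThan prod.lessThan_Suc_shift mult.assoc del: prod.lessThan_Suc)

lemma qpoch_zero_left [simp]: "qpoch 0 p n = 1"
  by (simp add: qpoch_lessThan)

lemma one_minus_nonzero:
  fixes z :: complex
  assumes "norm z < 1"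
  shows "1 - z \<noteq> 0"
  using assms by auto

lemma norm_mult_power_less:
  fixes a p :: complex
  assumes "norm p \<le> 1" "norm a < 1"
  shows "norm (a * p ^ j) < 1"
proof -
  have "norm (a * p ^ j) = norm a * norm p ^ j"
    by (simp add: norm_mult norm_power)
  also have "\<dots> \<le> norm a * 1"
    using assms by (intro mult_left_mono power_le_one) auto
  finally show ?thesis
    using assms by simp
qed

lemma qpoch_nonzero:
  assumes "norm p \<le> 1" "norm a < 1"
  shows "qpoch a p n \<noteq> 0"
  using one_minus_nonzero[OF norm_mult_power_less[OF assms]]
  by (simp add: qpoch_lessThan)

text \<open>Each factor has norm at most 1 + A. Geometric growth in n is a good enough bound because
  the series carry the quadratic exponent \<open>(n + 1) choose 2\<close>. The bound uses A instead
  of \<open>norm a\<close> so that it can be uniform over a family of parameters.\<close>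

lemma norm_qpoch_le:
  assumes "norm p \<le> 1" "norm a \<le> A"
  shows "norm (qpoch a p n) \<le> (1 + A) ^ n"
proof -
  have "norm (1 - a * p ^ j) \<le> 1 + A" for j
  proof -
    have "norm (1 - a * p ^ j) \<le> 1 + norm a * norm p ^ j"
      using norm_triangle_ineq4[of 1 "a * p ^ j"] by (simp add: norm_mult norm_power)
    also have "norm a * norm p ^ j \<le> A * 1"
      using assms by (intro mult_mono power_le_one) (auto intro: order_trans[OF norm_ge_zero])
    finally show ?thesis by simp
  qed
  then have "(\<Prod>j<n. norm (1 - a * p ^ j)) \<le> (\<Prod>j<n. 1 + A)"
    by (intro prod_mono) auto
  then show ?thesis
    by (simp add: qpoch_lessThan prod_norm)
qed

text \<open>Keeping r apart from \<open>norm a\<close> lets the same bound with r = |q| serve both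
  denominators, \<open>(q)_n\<close> and \<open>(abq;q^2)_n\<close>.\<close>

lemma norm_qpoch_ge:
  assumes "norm p \<le> 1" "norm a \<le> r" "r < 1"
  shows "(1 - r) ^ n \<le> norm (qpoch a p n)"
proof -
  have "1 - r \<le> norm (1 - a * p ^ j)" for j
  proof -
    have "norm a * norm p ^ j \<le> r * 1"
      using assms by (intro mult_mono power_le_one) (auto intro: order_trans[OF norm_ge_zero])
    then show ?thesis
      using norm_triangle_ineq2[of 1 "a * p ^ j"] by (simp add: norm_mult norm_power)
  qed
  then have "(\<Prod>j<n. 1 - r) \<le> (\<Prod>j<n. norm (1 - a * p ^ j))"
    using assms by (intro prod_mono) auto
  then show ?thesis
    by (simp add: qpoch_lessThan prod_norm)
qed

lemma qpoch_tendsto: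
  assumes "norm p < 1"
  shows "(\<lambda>n. qpoch a p n) \<longlonglongrightarrow> qpoch_inf a p"
  using has_prod_imp_tendsto'[OF qpoch_inf_has_prod[OF assms]]
  by (simp add: qpoch_lessThan)

lemma qpoch_inf_nonzero:
  assumes "norm p < 1" "norm a < 1"
  shows "qpoch_inf a p \<noteq> 0"
proof -
  have "1 - a * p ^ j \<noteq> 0" for j
    using assms by (intro one_minus_nonzero norm_mult_power_less) auto
  then have "0 \<notin> range (\<lambda>j. 1 - a * p ^ j)"
    by (auto simp del: right_minus_eq)
  then show ?thesis
    using has_prod_eq_0_iff[OF qpoch_inf_has_prod[OF assms(1), of a]] by simp
qed

section \<open>Product identities: dissection modulo k, square and cube roots of unity, Euler's
  theorem\<close>

lemma qpoch_inf_split: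
  assumes "norm p < 1" "k > 0"
  shows "qpoch_inf a p = (\<Prod>i<k. qpoch_inf (a * p ^ i) (p ^ k))"
proof (rule LIMSEQ_unique)
  \<comment> \<open>Writing the exponent as \<open>m * k + i\<close> with i < k sorts the first
    \<open>n * k\<close> factors by their residue modulo k. The limit is then taken along multiples
    of k only.\<close>
  have *: "qpoch a p (n * k) = (\<Prod>i<k. qpoch (a * p ^ i) (p ^ k) n)" for n
  proof -
    have "qpoch a p (n * k) = (\<Prod>m<n. \<Prod>j=m*k..<m*k+k. 1 - a * p ^ j)"
      by (simp add: qpoch_lessThan prod.nat_group)
    also have "\<dots> = (\<Prod>m<n. \<Prod>i<k. 1 - a * p ^ i * (p ^ k) ^ m)"
    proof (rule prod.cong[OF refl])
      fix m
      have "(\<Prod>i<k. 1 - a * p ^ i * (p ^ k) ^ m) = (\<Prod>j=m*k..<m*k+k. 1 - a * p ^ j)"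
        by (rule prod.reindex_bij_witness[of _ "\<lambda>j. j - m * k" "\<lambda>i. m * k + i"])
          (auto simp: power_add power_mult[symmetric] mult.commute mult.left_commute)
      then show "(\<Prod>j=m*k..<m*k+k. 1 - a * p ^ j) = (\<Prod>i<k. 1 - a * p ^ i * (p ^ k) ^ m)"
        by (rule sym)
    qed
    also have "\<dots> = (\<Prod>i<k. qpoch (a * p ^ i) (p ^ k) n)"
      unfolding qpoch_lessThan by (rule prod.swap)
    finally show ?thesis .
  qed
  have "filterlim (\<lambda>n. n * k) sequentially sequentially"
    using assms(2) by (simp add: filterlim_at_top_mult_tendsto_pos mult_nat_right_at_top)
  from filterlim_compose[OF qpoch_tendsto[OF assms(1), of a] this]
  show "(\<lambda>n. \<Prod>i<k. qpoch (a * p ^ i) (p ^ k) n) \<longlonglongrightarrow> qpoch_inf a p"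
    by (simp add: *)
  have "norm (p ^ k) < 1"
    using assms by (simp add: norm_power power_less_one_iff)
  then show "(\<lambda>n. \<Prod>i<k. qpoch (a * p ^ i) (p ^ k) n)
      \<longlonglongrightarrow> (\<Prod>i<k. qpoch_inf (a * p ^ i) (p ^ k))"
    by (intro tendsto_prod qpoch_tendsto)
qed

lemma qpoch_mult_minus: "qpoch a p n * qpoch (- a) p n = qpoch (a^2) (p^2) n"
  unfolding qpoch_lessThan prod.distrib[symmetric]
  by (intro prod.cong) (simp_all add: algebra_simps power2_eq_square power_mult_distrib)

lemma qpoch_inf_mult_minus:
  assumes "norm p < 1"
  shows "qpoch_inf a p * qpoch_inf (- a) p = qpoch_inf (a^2) (p^2)"
proof (rule LIMSEQ_unique)
  show "(\<lambda>n. qpoch (a^2) (p^2) n) \<longlonglongrightarrow> qpoch_inf a p * qpoch_inf (- a) p"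
    unfolding qpoch_mult_minus[symmetric] by (intro tendsto_mult qpoch_tendsto assms)
  show "(\<lambda>n. qpoch (a^2) (p^2) n) \<longlonglongrightarrow> qpoch_inf (a^2) (p^2)"
    using assms by (intro qpoch_tendsto) (simp add: norm_power power_less_one_iff)
qed

text \<open>The hypothesis gives (1 - y)(1 - wy)(1 - w^2 y) = 1 - y^3, applied to y = a p^j factor
  by factor.\<close>

lemma qpoch_mult_cube_roots:
  assumes "1 + w + w^2 = 0"
  shows "qpoch a p n * (qpoch (w * a) p n * qpoch (w^2 * a) p n) = qpoch (a^3) (p^3) n"
proof -
  have "(1 - y) * ((1 - w * y) * (1 - w^2 * y)) = 1 - y^3" for y
    using assms by algebra
  then have "(1 - a * p ^ j) * ((1 - w * a * p ^ j) * (1 - w^2 * a * p ^ j)) = 1 - (a * p ^ j)^3" for j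
    by (simp only: mult.assoc)
  moreover have "(a * p ^ j)^3 = a^3 * (p^3) ^ j" for j
    by (simp add: power_mult_distrib mult.commute[of j] flip: power_mult)
  ultimately have "(1 - a * p ^ j) * ((1 - w * a * p ^ j) * (1 - w^2 * a * p ^ j)) = 1 - a^3 * (p^3) ^ j" for j
    by simp
  then show ?thesis
    by (simp add: qpoch_lessThan flip: prod.distrib)
qed

lemma qpoch_inf_mult_cube_roots:
  assumes "norm p < 1" "1 + w + w^2 = 0"
  shows "qpoch_inf a p * (qpoch_inf (w * a) p * qpoch_inf (w^2 * a) p) = qpoch_inf (a^3) (p^3)"
proof (rule LIMSEQ_unique)
  show "(\<lambda>n. qpoch (a^3) (p^3) n) \<longlonglongrightarrow>
      qpoch_inf a p * (qpoch_inf (w * a) p * qpoch_inf (w^2 * a) p)"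
    unfolding qpoch_mult_cube_roots[OF assms(2), symmetric]
    by (intro tendsto_mult qpoch_tendsto assms)
  show "(\<lambda>n. qpoch (a^3) (p^3) n) \<longlonglongrightarrow> qpoch_inf (a^3) (p^3)"
    using assms by (intro qpoch_tendsto) (simp add: norm_power power_less_one_iff)
qed

text \<open>Euler's theorem on partitions into odd and into distinct parts. Both (q)_inf =
  (q;q^2)_inf (q^2;q^2)_inf and (q)_inf (-q)_inf = (q^2;q^2)_inf hold, and the nonzero factor
  (q^2;q^2)_inf cancels.\<close>

lemma euler_odd_distinct:
  assumes "norm q < 1"
  shows "qpoch_inf q (q^2) * qpoch_inf (- q) q = 1"
proof -
  have q2: "norm (q^2) < 1"
    using assms by (simp add: norm_power power_less_one_iff)
  have "qpoch_inf q q = qpoch_inf q (q^2) * qpoch_inf (q^2) (q^2)"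
    using qpoch_inf_split[OF assms, of 2 q] by (simp add: lessThan_Suc numeral_2_eq_2 mult.commute)
  moreover have "qpoch_inf q q * qpoch_inf (- q) q = qpoch_inf (q^2) (q^2)"
    by (rule qpoch_inf_mult_minus[OF assms])
  moreover have "qpoch_inf (q^2) (q^2) \<noteq> 0"
    using q2 by (rule qpoch_inf_nonzero[rotated])(use q2 in auto)
  ultimately show ?thesis
    by (metis mult.assoc mult.commute mult_cancel_left2)
qed

section \<open>Andrews' series: majorant, convergence and telescoping\<close>

definition andrews_term :: "complex \<Rightarrow> complex \<Rightarrow> complex \<Rightarrow> nat \<Rightarrow> complex" where
  "andrews_term q a b n = qpoch a q n * qpoch b q n * q ^ ((n + 1) choose 2)
     / (qpoch q q n * qpoch (a * b * q) (q^2) n)"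

lemma choose_two_Suc: "Suc n + 1 choose 2 = (n + 1 choose 2) + Suc n"
  by (simp add: numeral_2_eq_2)

text \<open>The ratio of consecutive terms is \<open>K * r ^ Suc n\<close>, which tends to 0 however
  large K is, so it is eventually below 1/2.\<close>

lemma summable_power_triangle:
  fixes K r :: real
  assumes "0 \<le> K" "0 \<le> r" "r < 1"
  shows "summable (\<lambda>n. K ^ n * r ^ ((n + 1) choose 2))"
proof -
  have "(\<lambda>n. K * r ^ Suc n) \<longlonglongrightarrow> K * 0"
    using assms by (intro tendsto_mult tendsto_const LIMSEQ_Suc LIMSEQ_power_zero) auto
  then have "eventually (\<lambda>n. K * r ^ Suc n < 1/2) sequentially"
    by (intro order_tendstoD) auto
  then obtain N where N: "\<And>n. n \<ge> N \<Longrightarrow> K * r ^ Suc n < 1/2"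
    by (auto simp: eventually_sequentially)
  show ?thesis
  proof (rule summable_ratio_test[of "1/2" N])
    fix n assume "n \<ge> N"
    have "norm (K ^ Suc n * r ^ (Suc n + 1 choose 2))
        = (K * r ^ Suc n) * (K ^ n * r ^ ((n + 1) choose 2))"
      unfolding choose_two_Suc using assms by (simp add: power_add)
    also have "\<dots> \<le> 1/2 * (K ^ n * r ^ ((n + 1) choose 2))"
      using assms N[OF \<open>n \<ge> N\<close>] by (intro mult_right_mono) auto
    finally show "norm (K ^ Suc n * r ^ (Suc n + 1 choose 2))
        \<le> 1/2 * norm (K ^ n * r ^ ((n + 1) choose 2))"
      using assms by simp
  qed simp
qed

text \<open>A and B are bounds for |a| and |b|, not the norms themselves, so that one majorant
  dominates the series for all parameters b q^(2m) at once.\<close>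

definition andrews_majorant :: "real \<Rightarrow> real \<Rightarrow> real \<Rightarrow> nat \<Rightarrow> real" where
  "andrews_majorant r A B n =
     ((1 + A) * (1 + B) / ((1 - r) * (1 - r))) ^ n * r ^ ((n + 1) choose 2)"

lemma summable_andrews_majorant:
  assumes "0 \<le> r" "r < 1" "0 \<le> A" "0 \<le> B"
  shows "summable (andrews_majorant r A B)"
  unfolding andrews_majorant_def [abs_def] using assms by (intro summable_power_triangle) auto

text \<open>Numerator and denominator factors are left abstract so that the estimate covers both the
  terms of the series and the remainder \<open>andrews_rest\<close>.\<close>

lemma norm_quotient_le_majorant:
  fixes x y u v :: complex
  assumes "norm q < 1" "0 \<le> A" "0 \<le> B"
    and "norm x \<le> (1 + A) ^ n" "norm y \<le> (1 + B) ^ n"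
    and "(1 - norm q) ^ n \<le> norm u" "(1 - norm q) ^ n \<le> norm v"
  shows "norm (x * y * q ^ ((n + 1) choose 2) / (u * v)) \<le> andrews_majorant (norm q) A B n"
proof -
  have "norm (x * y * q ^ ((n + 1) choose 2) / (u * v))
      = norm x * norm y * norm q ^ ((n + 1) choose 2) / (norm u * norm v)"
    by (simp add: norm_mult norm_divide norm_power)
  also have "\<dots> \<le> (1 + A) ^ n * (1 + B) ^ n * norm q ^ ((n + 1) choose 2)
      / ((1 - norm q) ^ n * (1 - norm q) ^ n)"
    using assms by (intro frac_le mult_mono mult_pos_pos mult_nonneg_nonneg) auto
  also have "\<dots> = andrews_majorant (norm q) A B n"
    by (simp add: andrews_majorant_def power_divide power_mult_distrib)
  finally show ?thesis .
qed

text \<open>This is the purpose of the assumption |ab| \<le> 1: it keeps |abq| \<le> |q| < 1, so no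
  factor of \<open>(abq;q^2)_n\<close> vanishes.\<close>

lemma norm_mult_q_le:
  fixes a b q :: complex
  assumes "norm (a * b) \<le> 1"
  shows "norm (a * b * q) \<le> norm q"
  using assms mult_right_mono[of "norm (a * b)" 1 "norm q"] by (simp add: norm_mult)

lemma norm_andrews_term_le:
  assumes "norm q < 1" "norm (a * b) \<le> 1" "norm a \<le> A" "norm b \<le> B"
  shows "norm (andrews_term q a b n) \<le> andrews_majorant (norm q) A B n"
  unfolding andrews_term_def
proof (rule norm_quotient_le_majorant)
  show "(1 - norm q) ^ n \<le> norm (qpoch (a * b * q) (q^2) n)"
    using assms norm_mult_q_le[OF assms(2), of q]
    by (intro norm_qpoch_ge) (auto simp: norm_power power_le_one)
  show "0 \<le> A" "0 \<le> B"
    using assms norm_ge_zero order_trans by blast+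
qed (use assms in \<open>auto intro!: norm_qpoch_le norm_qpoch_ge\<close>)

lemma summable_andrews_term:
  assumes "norm q < 1" "norm (a * b) \<le> 1"
  shows "summable (andrews_term q a b)"
  by (rule summable_comparison_test'[OF summable_andrews_majorant[of "norm q" "norm a" "norm b"]])
    (use assms norm_andrews_term_le[OF assms order_refl order_refl] in auto)

lemma andrews_term_commute: "andrews_term q a b = andrews_term q b a"
  by (simp add: andrews_term_def [abs_def] mult.commute mult.left_commute)

text \<open>The certificate of the telescoping sum is \<open>b (1 - q\<^sup>n) / (1 - b)\<close> times the \<open>n\<close>-th term.
  It is shifted by one and \<open>1 - b\<close> is cancelled against the first factor of \<open>(b)\<^sub>n\<close>, so that
  \<open>b = 1\<close>, the value that determines the constant, is allowed.\<close>

definition andrews_rest :: "complex \<Rightarrow> complex \<Rightarrow> complex \<Rightarrow> nat \<Rightarrow> complex" where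
  "andrews_rest q a b n = b * (qpoch a q (Suc n) * qpoch (b * q) q n * q ^ ((Suc n + 1) choose 2)
     / (qpoch q q n * qpoch (a * b * q) (q^2) (Suc n)))"

lemma andrews_rest_tendsto_0:
  assumes "norm q < 1" "norm (a * b) \<le> 1"
  shows "andrews_rest q a b \<longlonglongrightarrow> 0"
proof (rule Lim_null_comparison)
  let ?M = "\<lambda>n. norm b * andrews_majorant (norm q) (norm a) (norm b) (Suc n)"
  show "?M \<longlonglongrightarrow> 0"
    using assms
    by (intro tendsto_mult_right_zero LIMSEQ_Suc summable_LIMSEQ_zero summable_andrews_majorant) auto
  have "norm (andrews_rest q a b n) \<le> ?M n" for n
    unfolding andrews_rest_def norm_mult[of b]
  proof (intro mult_left_mono norm_quotient_le_majorant)
    show "(1 - norm q) ^ Suc n \<le> norm (qpoch (a * b * q) (q^2) (Suc n))"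
      using assms norm_mult_q_le[OF assms(2), of q]
      by (intro norm_qpoch_ge) (auto simp: norm_power power_le_one)
    \<comment> \<open>The remainder mixes factorials of lengths n and n + 1. The bounds for the
      shorter ones are weakened to exponent n + 1, so that the majorant at index
      \<open>Suc n\<close> applies.\<close>
    have "(1 - norm q) ^ Suc n \<le> (1 - norm q) ^ n"
      using assms by (intro power_decreasing) auto
    also have "\<dots> \<le> norm (qpoch q q n)"
      using assms by (intro norm_qpoch_ge) auto
    finally show "(1 - norm q) ^ Suc n \<le> norm (qpoch q q n)" .
    have "norm (b * q) \<le> norm b"
      using assms mult_left_mono[of "norm q" 1 "norm b"] by (simp add: norm_mult)
    then have "norm (qpoch (b * q) q n) \<le> (1 + norm b) ^ n"
      using assms by (intro norm_qpoch_le) auto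
    also have "\<dots> \<le> (1 + norm b) ^ Suc n"
      by (intro power_increasing) auto
    finally show "norm (qpoch (b * q) q n) \<le> (1 + norm b) ^ Suc n" .
  qed (use assms in \<open>auto intro!: norm_qpoch_le simp del: power_Suc\<close>)
  then show "\<forall>\<^sub>F n in sequentially. norm (andrews_rest q a b n) \<le> ?M n"
    by simp
qed

text \<open>The induction step of \<open>sum_andrews_term\<close> as a rational identity, with X =
  q^(n+1), A = (a)_(n+1), B = (bq)_n, Q = (q)_n, E = (abq;q^2)_(n+1) and W the power of q in term n
  + 1. Over the common denominator it becomes a polynomial identity.\<close>

lemma andrews_telescope_algebra:
  fixes a b q X A B W Q E :: complex
  assumes "1 - X \<noteq> 0" "Q \<noteq> 0" "E \<noteq> 0" "1 - a * b * q * X^2 \<noteq> 0"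
  shows "A * ((1 - b) * B) * W / (Q * (1 - X) * E) + b * (A * B * W / (Q * E))
    = A * (B * (1 - b * X) * (1 - b * q * X)) * W / (Q * (1 - X) * (E * (1 - a * b * q * X^2)))
      + b * (A * (1 - a * X) * (B * (1 - b * X)) * (W * (q * X))
          / (Q * (1 - X) * (E * (1 - a * b * q * X^2))))"
proof -
  have *: "x / (Q * (1 - X) * E) = x * (1 - a * b * q * X^2) / (Q * (1 - X) * (E * (1 - a * b * q * X^2)))"
    "x / (Q * E) = x * (1 - X) * (1 - a * b * q * X^2) / (Q * (1 - X) * (E * (1 - a * b * q * X^2)))" for x
    using assms by simp_all
  show ?thesis
    unfolding * times_divide_eq_right add_divide_distrib[symmetric]
    by (rule arg_cong[of _ _ "\<lambda>x. x / _"]) algebra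
qed

text \<open>Both sides are (bq)_(n+2): the left splits off the first factor, the right the last
  two.\<close>

lemma qpoch_shift2:
  "(1 - b * q) * qpoch (b * q^2) q (Suc n)
    = qpoch (b * q) q n * (1 - b * q ^ Suc n) * (1 - b * q * q ^ Suc n)"
proof -
  have "(1 - b * q) * qpoch (b * q^2) q (Suc n) = qpoch (b * q) q (Suc (Suc n))"
    by (simp add: qpoch_Suc_left[of "b * q"] power2_eq_square mult.assoc)
  then show ?thesis
    by (simp add: qpoch_Suc mult.assoc)
qed

text \<open>Finite form of the shift b to b q^2, with the telescoped difference as explicit
  remainder. For n = 0 it reads 1 - abq = (1 - bq) + bq(1 - a) after clearing the
  denominator.\<close>

lemma sum_andrews_term:
  assumes "norm q < 1" "norm (a * b) \<le> 1"
  shows "(\<Sum>k\<le>n. andrews_term q a b k)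
    = (1 - b * q) / (1 - a * b * q) * (\<Sum>k\<le>n. andrews_term q a (b * q^2) k)
      + andrews_rest q a b n"
proof -
  have abq: "norm (a * b * q) < 1"
    using norm_mult_q_le[OF assms(2)] assms(1) by (rule order.strict_trans1)
  have q2: "norm (q^2) \<le> 1"
    using assms by (simp add: norm_power power_le_one)
  have nz: "1 - a * b * q \<noteq> 0"
    using abq by (rule one_minus_nonzero)
  show ?thesis
  proof (induction n)
    case 0
    show ?case
      using nz by (simp add: andrews_term_def andrews_rest_def qpoch_Suc numeral_2_eq_2 field_simps)
  next
    case (Suc n)
    define X where "X = q ^ Suc n"
    define A where "A = qpoch a q (Suc n)"
    define B where "B = qpoch (b * q) q n"
    define W where "W = q ^ ((Suc n + 1) choose 2)"
    define Q where "Q = qpoch q q n"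
    define E where "E = qpoch (a * b * q) (q^2) (Suc n)"
    have X2: "(q^2) ^ Suc n = X^2"
      by (simp add: X_def power2_eq_square power_mult_distrib)
    have Q': "qpoch q q (Suc n) = Q * (1 - X)"
      by (simp add: Q_def X_def qpoch_Suc)
    have E': "qpoch (a * b * q) (q^2) (Suc (Suc n)) = E * (1 - a * b * q * X^2)"
      unfolding E_def X2[symmetric] by (rule qpoch_Suc)
    \<comment> \<open>Replacing b by b q^2 moves abq one step along base q^2, so the prefactor 1 -
      abq is exactly the missing first factor.\<close>
    have E'': "(1 - a * b * q) * qpoch (a * (b * q^2) * q) (q^2) (Suc n) = E * (1 - a * b * q * X^2)"
      unfolding E'[symmetric] qpoch_Suc_left[of "a * b * q" _ "Suc n"] by (simp add: mult_ac)
    have b1: "qpoch b q (Suc n) = (1 - b) * B"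
      by (simp add: B_def qpoch_Suc_left)
    have t1: "andrews_term q a b (Suc n) = A * ((1 - b) * B) * W / (Q * (1 - X) * E)"
      unfolding andrews_term_def Q' b1 A_def W_def E_def ..
    have "(1 - b * q) / (1 - a * b * q) * andrews_term q a (b * q^2) (Suc n)
        = A * ((1 - b * q) * qpoch (b * q^2) q (Suc n)) * W
          / (Q * (1 - X) * ((1 - a * b * q) * qpoch (a * (b * q^2) * q) (q^2) (Suc n)))"
      unfolding andrews_term_def Q' A_def W_def by (simp add: mult_ac)
    then have t2: "(1 - b * q) / (1 - a * b * q) * andrews_term q a (b * q^2) (Suc n)
        = A * (B * (1 - b * X) * (1 - b * q * X)) * W / (Q * (1 - X) * (E * (1 - a * b * q * X^2)))"
      unfolding E'' qpoch_shift2 B_def X_def .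
    have r1: "andrews_rest q a b n = b * (A * B * W / (Q * E))"
      unfolding andrews_rest_def A_def B_def W_def Q_def E_def ..
    have W': "q ^ ((Suc (Suc n) + 1) choose 2) = W * (q * X)"
      unfolding choose_two_Suc[of "Suc n"] W_def X_def by (simp add: power_add)
    have r2: "andrews_rest q a b (Suc n) = b * (A * (1 - a * X) * (B * (1 - b * X)) * (W * (q * X))
          / (Q * (1 - X) * (E * (1 - a * b * q * X^2))))"
      unfolding andrews_rest_def Q' E' W'
      by (simp only: qpoch_Suc[of a q "Suc n"] qpoch_Suc[of "b * q"] A_def B_def X_def mult.assoc power_Suc)
    have "Q * (1 - X) \<noteq> 0" "E * (1 - a * b * q * X^2) \<noteq> 0"
      unfolding Q'[symmetric] E'[symmetric] using assms abq q2 by (intro qpoch_nonzero; simp)+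
    then have "andrews_term q a b (Suc n) + andrews_rest q a b n
        = (1 - b * q) / (1 - a * b * q) * andrews_term q a (b * q^2) (Suc n) + andrews_rest q a b (Suc n)"
      unfolding t1 t2 r1 r2 by (intro andrews_telescope_algebra) auto
    then show ?case
      unfolding sum.atMost_Suc distrib_left Suc.IH by (simp only: add.assoc add.commute[of "andrews_rest q a b n"])
  qed
qed

section \<open>Iterating the shift: the evaluation of Andrews' sum\<close>

definition andrews_sum :: "complex \<Rightarrow> complex \<Rightarrow> complex \<Rightarrow> complex" where
  "andrews_sum q a b = (\<Sum>n. andrews_term q a b n)"

lemma norm_shift_le:
  fixes a b q :: complex
  assumes "norm q < 1" "norm (a * b) \<le> 1"
  shows "norm (a * (b * q ^ m)) \<le> 1"
proof -
  have "norm (a * b) * norm q ^ m \<le> 1 * 1"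
    using assms by (intro mult_mono power_le_one) auto
  then show ?thesis
    by (simp add: norm_mult norm_power mult.assoc)
qed

lemma andrews_sum_shift:
  assumes "norm q < 1" "norm (a * b) \<le> 1"
  shows "(1 - a * b * q) * andrews_sum q a b = (1 - b * q) * andrews_sum q a (b * q^2)"
proof -
  have nz: "1 - a * b * q \<noteq> 0"
    using order.strict_trans1[OF norm_mult_q_le[OF assms(2)] assms(1)] by (rule one_minus_nonzero)
  have "(\<lambda>n. \<Sum>k\<le>n. andrews_term q a b k) \<longlonglongrightarrow> andrews_sum q a b"
    unfolding andrews_sum_def by (intro summable_LIMSEQ' summable_andrews_term assms)
  moreover have "(\<lambda>n. \<Sum>k\<le>n. andrews_term q a b k)
      \<longlonglongrightarrow> (1 - b * q) / (1 - a * b * q) * andrews_sum q a (b * q^2) + 0"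
    unfolding andrews_sum_def sum_andrews_term[OF assms]
    using assms by (intro tendsto_add tendsto_mult tendsto_const summable_LIMSEQ'
        summable_andrews_term norm_shift_le andrews_rest_tendsto_0)
  ultimately have "andrews_sum q a b
      = (1 - b * q) / (1 - a * b * q) * andrews_sum q a (b * q^2) + 0"
    by (rule LIMSEQ_unique)
  then show ?thesis
    using nz by simp
qed

lemma andrews_sum_iterate:
  assumes "norm q < 1" "norm (a * b) \<le> 1"
  shows "qpoch (a * b * q) (q^2) m * andrews_sum q a b
    = qpoch (b * q) (q^2) m * andrews_sum q a (b * q ^ (2 * m))"
proof (induction m)
  case (Suc m)
  let ?b = "b * q ^ (2 * m)"
  have e1: "(q^2) ^ m = q ^ (2 * m)"
    by (simp only: power_mult)
  have e2: "b * q ^ (2 * Suc m) = ?b * q^2"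
    by (simp add: power2_eq_square mult_ac)
  have "qpoch (a * b * q) (q^2) (Suc m) * andrews_sum q a b
      = (1 - a * ?b * q) * (qpoch (a * b * q) (q^2) m * andrews_sum q a b)"
    unfolding qpoch_Suc e1 by (simp only: mult_ac)
  also have "\<dots> = qpoch (b * q) (q^2) m * ((1 - a * ?b * q) * andrews_sum q a ?b)"
    unfolding Suc.IH by simp
  also have "\<dots> = qpoch (b * q) (q^2) m * ((1 - ?b * q) * andrews_sum q a (?b * q^2))"
    using andrews_sum_shift[of q a ?b] assms norm_shift_le by simp
  also have "\<dots> = qpoch (b * q) (q^2) (Suc m) * andrews_sum q a (b * q ^ (2 * Suc m))"
    unfolding qpoch_Suc e1 e2 by (simp only: mult_ac)
  finally show ?case .
qed simp

lemma andrews_term_tendsto: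
  assumes "norm q < 1" "norm (a * b) \<le> 1"
  shows "(\<lambda>m. andrews_term q a (b * q ^ (2 * m)) n) \<longlonglongrightarrow> andrews_term q a 0 n"
proof -
  have "norm (q^2) < 1"
    using assms by (simp add: norm_power power_less_one_iff)
  then have lim: "(\<lambda>m. b * q ^ (2 * m)) \<longlonglongrightarrow> 0"
    by (simp only: power_mult) (intro tendsto_mult_right_zero LIMSEQ_power_zero)
  \<comment> \<open>Each term is a rational function of b, so termwise convergence only needs its
    denominator at b = 0, namely (q)_n, to be nonzero.\<close>
  have "qpoch q q n * qpoch (a * 0 * q) (q^2) n \<noteq> 0"
    using assms qpoch_nonzero[of q q n] by simp
  then show ?thesis
    unfolding andrews_term_def qpoch_lessThan by (intro tendsto_intros lim)
qed

text \<open>Tannery's theorem: since |b q^(2m)| \<le> |b|, the majorant for |a| and |b| dominates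
  all these series independently of m.\<close>

lemma andrews_sum_tendsto:
  assumes "norm q < 1" "norm (a * b) \<le> 1"
  shows "(\<lambda>m. andrews_sum q a (b * q ^ (2 * m))) \<longlonglongrightarrow> andrews_sum q a 0"
  unfolding andrews_sum_def
proof (rule tannerys_theorem[THEN conjunct2, THEN conjunct2])
  let ?M = "andrews_majorant (norm q) (norm a) (norm b)"
  show "(\<lambda>m. andrews_term q a (b * q ^ (2 * m)) n) \<longlonglongrightarrow> andrews_term q a 0 n" for n
    by (rule andrews_term_tendsto[OF assms])
  have "norm (andrews_term q a (b * q ^ (2 * m)) n) \<le> ?M n" for m n
  proof (rule norm_andrews_term_le)
    show "norm (b * q ^ (2 * m)) \<le> norm b"
      using assms mult_left_mono[of "norm q ^ (2 * m)" 1 "norm b"]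
      by (simp add: norm_mult norm_power power_le_one)
  qed (use assms norm_shift_le in auto)
  then show "\<forall>\<^sub>F (n, m) in sequentially \<times>\<^sub>F sequentially.
      norm (andrews_term q a (b * q ^ (2 * m)) n) \<le> ?M n"
    by (intro always_eventually) auto
  show "summable ?M"
    using assms by (intro summable_andrews_majorant) auto
qed simp

lemma andrews_sum_eq:
  assumes "norm q < 1" "norm (a * b) \<le> 1"
  shows "qpoch_inf (a * b * q) (q^2) * andrews_sum q a b = qpoch_inf (b * q) (q^2) * andrews_sum q a 0"
proof (rule LIMSEQ_unique)
  have q2: "norm (q^2) < 1"
    using assms by (simp add: norm_power power_less_one_iff)
  show "(\<lambda>m. qpoch (a * b * q) (q^2) m * andrews_sum q a b)
      \<longlonglongrightarrow> qpoch_inf (a * b * q) (q^2) * andrews_sum q a b"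
    by (intro tendsto_intros qpoch_tendsto q2)
  show "(\<lambda>m. qpoch (a * b * q) (q^2) m * andrews_sum q a b)
      \<longlonglongrightarrow> qpoch_inf (b * q) (q^2) * andrews_sum q a 0"
    unfolding andrews_sum_iterate[OF assms]
    by (intro tendsto_intros qpoch_tendsto q2 andrews_sum_tendsto assms)
qed

lemma andrews_sum_commute: "andrews_sum q a b = andrews_sum q b a"
  unfolding andrews_sum_def by (simp add: andrews_term_commute)

text \<open>For n > 0 the factorial (1)_n contains the factor 1 - 1, so only the term n = 0
  survives.\<close>

lemma andrews_sum_one_right: "andrews_sum q a 1 = 1"
proof -
  have "andrews_term q a 1 n = 0" if "n \<noteq> 0" for n
    using that by (cases n) (simp_all add: andrews_term_def qpoch_Suc_left)
  then have "andrews_sum q a 1 = (\<Sum>n\<in>{0}. andrews_term q a 1 n)"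
    unfolding andrews_sum_def by (intro suminf_finite) auto
  then show ?thesis
    by (simp add: andrews_term_def numeral_2_eq_2)
qed

lemma qpoch_inf_zero_left [simp]: "qpoch_inf 0 p = 1"
  by (simp add: qpoch_inf_def)

lemma andrews_q_gauss_second:
  assumes "norm q < 1" "norm (a * b) \<le> 1"
  shows "qpoch_inf (a * b * q) (q^2) * andrews_sum q a b
    = qpoch_inf (- q) q * qpoch_inf (a * q) (q^2) * qpoch_inf (b * q) (q^2)"
proof -
  \<comment> \<open>\<open>andrews_sum_eq\<close> at the pair (0, a), where the product on the left
    is (0;q^2)_inf = 1, read through the symmetry of the sum.\<close>
  have zero: "andrews_sum q a 0 = qpoch_inf (a * q) (q^2) * andrews_sum q 0 0" for a
    using andrews_sum_eq[of q 0 a] assms by (simp add: andrews_sum_commute)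
  \<comment> \<open>The case a = 1 normalizes: its sum is 1, and Euler's theorem then identifies the
    constant as (-q)_inf.\<close>
  have "qpoch_inf q (q^2) * andrews_sum q 0 0 = 1"
    using zero[of 1] andrews_sum_one_right[of q 0] andrews_sum_commute[of q 0 1] by simp
  then have "andrews_sum q 0 0 = qpoch_inf (- q) q"
    using euler_odd_distinct[OF assms(1)] by (metis mult.assoc mult.commute mult.left_neutral)
  then show ?thesis
    using andrews_sum_eq[OF assms] zero[of a] by (simp add: mult_ac)
qed

section \<open>The case ab = 1 and its form without the initial term\<close>

lemma andrews_sum_reciprocal:
  assumes "norm q < 1" "a * b = 1"
  shows "andrews_sum q a b
    = (qpoch_inf (- q) q)^2 * (qpoch_inf (a * q) (q^2) * qpoch_inf (b * q) (q^2))"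
proof -
  have ab: "a * b * q = q" "norm (a * b) \<le> 1"
    using assms by simp_all
  \<comment> \<open>Inserting 1 = (q;q^2)_inf (-q)_inf avoids division: the first factor is
    (abq;q^2)_inf, and the second becomes the extra (-q)_inf of the result.\<close>
  have "andrews_sum q a b = qpoch_inf q (q^2) * qpoch_inf (- q) q * andrews_sum q a b"
    by (simp add: euler_odd_distinct[OF assms(1)])
  also have "\<dots> = qpoch_inf (- q) q * (qpoch_inf (a * b * q) (q^2) * andrews_sum q a b)"
    unfolding ab by (simp only: mult_ac)
  also have "\<dots> = (qpoch_inf (- q) q)^2 * (qpoch_inf (a * q) (q^2) * qpoch_inf (b * q) (q^2))"
    unfolding andrews_q_gauss_second[OF assms(1) ab(2)] power2_eq_square[of "qpoch_inf (- q) q"] by (simp only: mult_ac)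
  finally show ?thesis .
qed

lemma sums_andrews_reciprocal:
  assumes "norm q < 1" "a * b = 1"
  shows "(\<lambda>n. qpoch a q n * qpoch b q n * q ^ ((n + 1) choose 2) / (qpoch q q n * qpoch q (q^2) n))
    sums ((qpoch_inf (- q) q)^2 * (qpoch_inf (a * q) (q^2) * qpoch_inf (b * q) (q^2)))"
  using summable_sums[OF summable_andrews_term[of q a b]] assms
  by (simp add: andrews_term_def [abs_def] andrews_sum_reciprocal[symmetric] andrews_sum_def)

text \<open>The term n = 0 equals 1 and is removed, because the cube-root factorizations of (a)_n
  (b)_n split off the first factors and so need n \<ge> 1.\<close>

lemma sums_andrews_reciprocal_Suc:
  assumes "norm q < 1" "a * b = 1"
  shows "(\<lambda>n. qpoch a q (Suc n) * qpoch b q (Suc n) * q ^ ((n + 2) choose 2)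
      / (qpoch q q (n + 1) * qpoch q (q^2) (n + 1)))
    sums ((qpoch_inf (- q) q)^2 * (qpoch_inf (a * q) (q^2) * qpoch_inf (b * q) (q^2)) - 1)"
proof -
  define f where "f n = qpoch a q n * qpoch b q n * q ^ ((n + 1) choose 2)
    / (qpoch q q n * qpoch q (q^2) n)" for n
  have "f 0 = 1"
    by (simp add: f_def numeral_2_eq_2)
  then have "(\<lambda>n. f (Suc n)) sums ((qpoch_inf (- q) q)^2
      * (qpoch_inf (a * q) (q^2) * qpoch_inf (b * q) (q^2)) - 1)"
    using sums_andrews_reciprocal[OF assms] by (subst sums_Suc_iff) (simp add: f_def [abs_def])
  then show ?thesis
    by (simp add: f_def)
qed

lemma cube_root_product:
  assumes "norm p < 1" "norm a < 1" "1 + w + w^2 = 0"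
  shows "qpoch (w * a) p n * qpoch (w^2 * a) p n = qpoch (a^3) (p^3) n / qpoch a p n"
  using qpoch_mult_cube_roots[OF assms(3), of a p n] qpoch_nonzero[of p a n] assms
  by (simp add: field_simps)

lemma primitive_cube_root_exists: "\<exists>w::complex. 1 + w + w^2 = 0"
proof
  show "1 + Complex (- 1 / 2) (sqrt 3 / 2) + (Complex (- 1 / 2) (sqrt 3 / 2))^2 = 0"
    by (simp add: complex_eq_iff power2_eq_square)
qed

(* In the third and fourth identities the sum over n >= 1 is written as a sum over n >= 0
   with n replaced by n + 1 in every term. *)
theorem corollary3p8:
  fixes q :: complex
  assumes "norm q < 1"
  shows
    "(summable (\<lambda>n. (qpoch (-1) q n)^2 * q ^ ((n + 1) choose 2)
        / (qpoch q q n * qpoch q (q^2) n))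
     \<and> (\<Sum>n. (qpoch (-1) q n)^2 * q ^ ((n + 1) choose 2)
        / (qpoch q q n * qpoch q (q^2) n))
       = (qpoch_inf (-q) q)^2 * (qpoch_inf (-q) (q^2))^2)
     \<and> (summable (\<lambda>n. qpoch (-1) (q^2) n * q ^ ((n + 1) choose 2)
        / (qpoch q q n * qpoch q (q^2) n))
     \<and> (\<Sum>n. qpoch (-1) (q^2) n * q ^ ((n + 1) choose 2)
        / (qpoch q q n * qpoch q (q^2) n))
       = (qpoch_inf (-q) q)^2 * qpoch_inf (-(q^2)) (q^4))
     \<and> (summable (\<lambda>n. qpoch (q^3) (q^3) n * q ^ ((n + 2) choose 2)
        / (qpoch q q n * qpoch q q (n + 1) * qpoch q (q^2) (n + 1)))
     \<and> 1 + 3 * (\<Sum>n. qpoch (q^3) (q^3) n * q ^ ((n + 2) choose 2)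
        / (qpoch q q n * qpoch q q (n + 1) * qpoch q (q^2) (n + 1)))
       = (qpoch_inf (-q) q)^3 * qpoch_inf (q^3) (q^6))
     \<and> (summable (\<lambda>n. qpoch (-(q^3)) (q^3) n * q ^ ((n + 2) choose 2)
        / (qpoch (-q) q n * qpoch q q (n + 1) * qpoch q (q^2) (n + 1)))
     \<and> 1 + (\<Sum>n. qpoch (-(q^3)) (q^3) n * q ^ ((n + 2) choose 2)
        / (qpoch (-q) q n * qpoch q q (n + 1) * qpoch q (q^2) (n + 1)))
       = 1 / (qpoch_inf q (q^2) * qpoch_inf_list [q^2, q^3, q^9, q^10] (q^12)))"
proof -
  have q2: "norm (q^2) < 1" and q6: "norm (q^6) < 1"
    and q12: "norm (q^12) < 1"
    using assms by (simp_all add: norm_power power_less_one_iff)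
  obtain w :: complex where w: "1 + w + w^2 = 0"
    using primitive_cube_root_exists by blast
  then have w3: "w * w^2 = 1"
    by algebra
  note euler = euler_odd_distinct[OF assms]
  have ne: "qpoch_inf q (q^2) \<noteq> 0"
    using euler by auto

  have id1: "(\<lambda>n. (qpoch (-1) q n)^2 * q ^ ((n + 1) choose 2) / (qpoch q q n * qpoch q (q^2) n))
      sums ((qpoch_inf (-q) q)^2 * (qpoch_inf (-q) (q^2))^2)"
    using sums_andrews_reciprocal[OF assms, of "-1" "-1"] by (simp add: power2_eq_square)

  \<comment> \<open>Second identity, with a = i and b = -i: both product pairs collapse by (1 -
    iy)(1 + iy) = 1 + y^2.\<close>
  have "qpoch_inf (\<i> * q) (q^2) * qpoch_inf (- \<i> * q) (q^2) = qpoch_inf (-(q^2)) (q^4)"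
    using qpoch_inf_mult_minus[OF q2, of "\<i> * q"] by (simp add: power_mult_distrib flip: power_mult)
  moreover have "qpoch \<i> q n * qpoch (- \<i>) q n = qpoch (-1) (q^2) n" for n
    using qpoch_mult_minus[of \<i> q n] by simp
  ultimately have id2: "(\<lambda>n. qpoch (-1) (q^2) n * q ^ ((n + 1) choose 2)
      / (qpoch q q n * qpoch q (q^2) n)) sums ((qpoch_inf (-q) q)^2 * qpoch_inf (-(q^2)) (q^4))"
    using sums_andrews_reciprocal[OF assms, of \<i> "- \<i>"] by simp

  \<comment> \<open>Third identity, with a = w and b = w^2. The first factors give (1 - w)(1 - w^2)
    = 3, the source of the coefficient 3; the others combine to (q^3;q^3)_n / (q)_n.\<close>
  have num3: "qpoch w q (Suc n) * qpoch (w^2) q (Suc n) = 3 * (qpoch (q^3) (q^3) n / qpoch q q n)" for n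
  proof -
    have "(1 - w) * (1 - w^2) = 3"
      using w by algebra
    then show ?thesis
      using cube_root_product[OF assms assms w, of n] by (simp add: qpoch_Suc_left mult_ac)
  qed
  have "qpoch_inf q (q^2) * (qpoch_inf (w * q) (q^2) * qpoch_inf (w^2 * q) (q^2)) = qpoch_inf (q^3) (q^6)"
    using qpoch_inf_mult_cube_roots[OF q2 w, of q] by (simp flip: power_mult)
  \<comment> \<open>Dividing by (q;q^2)_inf amounts to multiplying by (-q)_inf, which yields the
    third power of (-q)_inf.\<close>
  then have "qpoch_inf (w * q) (q^2) * qpoch_inf (w^2 * q) (q^2)
      = qpoch_inf (-q) q * qpoch_inf (q^3) (q^6)"
    using euler by (metis mult.assoc mult.commute mult_1_left)
  then have "(\<lambda>n. 3 * (qpoch (q^3) (q^3) n * q ^ ((n + 2) choose 2)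
        / (qpoch q q n * qpoch q q (n + 1) * qpoch q (q^2) (n + 1))))
      sums ((qpoch_inf (-q) q)^3 * qpoch_inf (q^3) (q^6) - 1)"
    using sums_andrews_reciprocal_Suc[OF assms w3] unfolding num3
    by (simp add: power3_eq_cube power2_eq_square mult_ac)
  then have id3: "(\<lambda>n. qpoch (q^3) (q^3) n * q ^ ((n + 2) choose 2)
        / (qpoch q q n * qpoch q q (n + 1) * qpoch q (q^2) (n + 1)))
      sums (((qpoch_inf (-q) q)^3 * qpoch_inf (q^3) (q^6) - 1) / 3)"
    by (auto dest: sums_divide[of _ _ 3])

  \<comment> \<open>Fourth identity, with a = -w and b = -w^2. Now the first factors multiply to (1
    + w)(1 + w^2) = 1, and the cube-root product is taken at -q.\<close>
  have num4: "qpoch (- w) q (Suc n) * qpoch (- (w^2)) q (Suc n)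
      = qpoch (-(q^3)) (q^3) n / qpoch (-q) q n" for n
  proof -
    have "(1 + w) * (1 + w^2) = 1"
      using w by algebra
    then show ?thesis
      using cube_root_product[OF assms _ w, of "-q" n] assms by (simp add: qpoch_Suc_left mult_ac)
  qed
  have cube: "qpoch_inf (-q) (q^2) * (qpoch_inf (- w * q) (q^2) * qpoch_inf (- (w^2) * q) (q^2))
      = qpoch_inf (-(q^3)) (q^6)"
    using qpoch_inf_mult_cube_roots[OF q2 w, of "-q"] by (simp flip: power_mult)
  \<comment> \<open>Exponents 3 mod 6 are 3 and 9 mod 12; below, exponents 2 mod 4 are 2, 6 and 10
    mod 12.\<close>
  have split2: "qpoch_inf (q^3) (q^6) = qpoch_inf (q^3) (q^12) * qpoch_inf (q^9) (q^12)"
    using qpoch_inf_split[OF q6, of 2 "q^3"]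
    by (simp add: numeral_2_eq_2 flip: power_mult power_add)
  have split3: "qpoch_inf (q^2) (q^4)
      = qpoch_inf (q^2) (q^12) * qpoch_inf (q^6) (q^12) * qpoch_inf (q^10) (q^12)"
  proof -
    have "(\<Prod>i<3::nat. f i) = f 0 * f 1 * f 2" for f :: "nat \<Rightarrow> complex"
      by (simp add: numeral_3_eq_3 numeral_2_eq_2)
    moreover have "q^2 * q^4 = q^6" "q^2 * (q^4)^2 = q^10" "(q^4)^3 = q^12"
      by (simp_all flip: power_mult power_add add: numeral_eq_Suc)
    moreover have "norm (q^4) < 1"
      using assms by (simp add: norm_power power_less_one_iff)
    ultimately show ?thesis
      using qpoch_inf_split[of "q^4" 3 "q^2"] by simp
  qed
  have m1: "qpoch_inf q (q^2) * qpoch_inf (-q) (q^2) = qpoch_inf (q^2) (q^4)"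
    using qpoch_inf_mult_minus[OF q2, of q] by (simp flip: power_mult)
  have m2: "qpoch_inf (q^3) (q^6) * qpoch_inf (-(q^3)) (q^6) = qpoch_inf (q^6) (q^12)"
    using qpoch_inf_mult_minus[OF q6, of "q^3"] by (simp flip: power_mult)
  have nz: "qpoch_inf (q^k) (q^12) \<noteq> 0" if "k > 0" for k
    using that assms by (intro qpoch_inf_nonzero q12) (simp add: norm_power power_less_one_iff)
  note nzs = nz[of 2] nz[of 3] nz[of 6] nz[of 9] nz[of 10]
  have prod4: "(qpoch_inf (-q) q)^2 * (qpoch_inf (- w * q) (q^2) * qpoch_inf (- (w^2) * q) (q^2))
      = 1 / (qpoch_inf q (q^2) * qpoch_inf_list [q^2, q^3, q^9, q^10] (q^12))" (is "?e^2 * ?P = _")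
  proof -
    let ?c = "\<lambda>k. qpoch_inf (q^k) (q^12)"
    \<comment> \<open>The factor (q^6;q^12)_inf is absent from the claim. Supplying it completes the
      class 2 mod 4; it reappears as (q^3;q^6)_inf (-q^3;q^6)_inf and then cancels. The factor
      (-q;q^2)_inf from \<open>m1\<close> is absorbed by \<open>cube\<close>.\<close>
    have "?c 6 * (qpoch_inf q (q^2) * ?P * (?c 2 * ?c 3 * ?c 9 * ?c 10))
        = qpoch_inf q (q^2) * ?P * (?c 3 * ?c 9) * (?c 2 * ?c 6 * ?c 10)"
      by simp
    also have "\<dots> = ?c 6 * (qpoch_inf q (q^2))^2"
      unfolding split2[symmetric] split3[symmetric] m1[symmetric]
      unfolding m2[symmetric] cube[symmetric]
        power2_eq_square[of "qpoch_inf q (q^2)"]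
      by (simp only: mult_ac)
    finally have "qpoch_inf q (q^2) * ?P * (?c 2 * ?c 3 * ?c 9 * ?c 10) = (qpoch_inf q (q^2))^2"
      using nzs by simp
    moreover have "?e = 1 / qpoch_inf q (q^2)"
      using euler ne by (simp add: field_simps)
    ultimately show ?thesis
      using ne nzs by (simp add: qpoch_inf_list_def field_simps power2_eq_square)
  qed
  have "(\<lambda>n. qpoch (-(q^3)) (q^3) n * q ^ ((n + 2) choose 2)
        / (qpoch (-q) q n * qpoch q q (n + 1) * qpoch q (q^2) (n + 1)))
      sums ((qpoch_inf (-q) q)^2 * (qpoch_inf (- w * q) (q^2) * qpoch_inf (- (w^2) * q) (q^2)) - 1)"
    using sums_andrews_reciprocal_Suc[OF assms, of "- w" "- (w^2)"] w3 unfolding num4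
    by (simp add: mult_ac)
  note id4 = this[unfolded prod4]

  have "1 + 3 * (\<Sum>n. qpoch (q^3) (q^3) n * q ^ ((n + 2) choose 2)
        / (qpoch q q n * qpoch q q (n + 1) * qpoch q (q^2) (n + 1)))
      = (qpoch_inf (-q) q)^3 * qpoch_inf (q^3) (q^6)"
    unfolding sums_unique[OF id3, symmetric] by (simp add: field_simps)
  with id1 id2 sums_summable[OF id3] id4 show ?thesis
    by (auto simp: sums_iff)
qed

end
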